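(* Let $\Gamma$ be a countable set, let $M$ be a measurable space, and let $\underline{X} = (X_k)_{k\in\Gamma}$ be a family of independent and identically distributed random variables with values in $M$. Let $E\subseteq M^\Gamma$ be an event, and suppose that for every finite set $J\subseteq\Gamma$, the event $E$ has an injective positional symmetry $\pi\colon\Gamma\to\Gamma$ such that $\pi(J)\cap J=\varnothing$. Then $\mathbb{P}(\underline{X}\in E)\in\{0,1\}$.
   Context: $M^\Gamma$ carries the product $\sigma$-algebra, and an event $E\subseteq M^\Gamma$ is a measurable subset. A positional symmetry of an event $E\subseteq M^\Gamma$ is a map $\pi\colon\Gamma\to\Gamma$ (not required a priori to be injective or surjective) such that for every $\underline{a}=(a_k)_{k\in\Gamma}\in M^\Gamma$, one has $\underline{a}\in E$ if and only if $\underline{a}^\pi:=(a_{\pi(k)})_{k\in\Gamma}\in E$. *)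

theory Defs
  imports "HOL-Probability.Probability"
begin

text \<open>
  Points of the power \<open>M\<^sup>\<Gamma>\<close> are the functions in \<open>\<Gamma> \<rightarrow>\<^sub>E space M\<close>, extended by
  \<open>undefined\<close> outside \<open>\<Gamma>\<close>, hence the restriction to \<open>\<Gamma>\<close> in the reindexed family.
\<close>

definition positional_symmetry ::
    "'i set \<Rightarrow> 'm measure \<Rightarrow> ('i \<Rightarrow> 'm) set \<Rightarrow> ('i \<Rightarrow> 'i) \<Rightarrow> bool"
  where "positional_symmetry \<Gamma> M E \<pi> \<longleftrightarrow>
    \<pi> \<in> \<Gamma> \<rightarrow> \<Gamma> \<and>
    (\<forall>a \<in> \<Gamma> \<rightarrow>\<^sub>E space M. a \<in> E \<longleftrightarrow> (\<lambda>k\<in>\<Gamma>. a (\<pi> k)) \<in> E)"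

end

theory Submission
  imports Defs
begin

text \<open>
  The symmetries act on the product space by measure-preserving maps \<open>T\<^sub>J\<close>, indexed by the finite
  sets \<open>J\<close>. If \<open>A\<close> and \<open>B\<close> are cylinder sets, then \<open>A\<close> and the preimage of \<open>B\<close> under \<open>T\<^sub>J\<close> depend
  on disjoint sets of coordinates, and hence are independent, as soon as \<open>J\<close> contains the supports
  of both. The limit of \<open>\<mu> (A \<inter> T\<^sub>J\<inverse> B)\<close> is therefore \<open>\<mu> A \<cdot> \<mu> B\<close>, first for a cylinder \<open>B\<close> and
  then, by a Dynkin argument, for every event \<open>B\<close>. Since \<open>T\<^sub>J\<inverse> E = E\<close>, the event \<open>E\<close> is independent
  of every cylinder, hence of itself.
\<close>

text \<open>For fixed \<open>A\<close>, the events \<open>B\<close> satisfying the limit form a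
  Dynkin system: complements pass through preimages, and countable disjoint unions reduce to
  exchanging a limit with a series. The \<pi>-\<lambda> theorem then extends the limit from the
  generator to all events.\<close>

lemma (in prob_space) tendsto_prob_Int_vimage:
  assumes G: "Int_stable G" "G \<subseteq> Pow (space M)" "sets M = sigma_sets (space M) G"
    and F: "F \<noteq> bot"
    and T: "\<And>j. T j \<in> measurable M M" "\<And>j. distr M M (T j) = M"
    and A: "A \<in> events"
    and gen: "\<And>B. B \<in> G \<Longrightarrow> ((\<lambda>j. prob (A \<inter> (T j -` B \<inter> space M))) \<longlongrightarrow> prob A * prob B) F"
    and B: "B \<in> events"
  shows "((\<lambda>j. prob (A \<inter> (T j -` B \<inter> space M))) \<longlongrightarrow> prob A * prob B) F"
proof -
  have sub: "C \<in> events" if "C \<in> sigma_sets (space M) G" for C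
    using that G(3) by simp
  have vim: "T j -` C \<inter> space M \<in> events" if "C \<in> events" for C j
    using T(1) that by (rule measurable_sets)
  have pres: "prob (T j -` C \<inter> space M) = prob C" if "C \<in> events" for C j
    using T measure_distr[OF T(1) that, of j] by simp
  have "B \<in> sigma_sets (space M) G"
    using B G(3) by simp
  with G(1,2) show ?thesis
  proof (induction rule: sigma_sets_induct_disjoint)
    case (basic C)
    then show ?case by (rule gen)
  next
    case empty
    show ?case by simp
  next
    case (compl C)
    have C: "C \<in> events" using compl(1) by (rule sub)
    have "prob (A \<inter> (T j -` (space M - C) \<inter> space M)) = prob A - prob (A \<inter> (T j -` C \<inter> space M))"
      for j
    proof -
      have "A \<inter> (T j -` (space M - C) \<inter> space M) = A - (T j -` C \<inter> space M)"
        using sets.sets_into_space[OF A] measurable_space[OF T(1)] by auto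
      then show ?thesis
        using finite_measure_Diff'[OF A vim[OF C]] by simp
    qed
    moreover have "((\<lambda>j. prob A - prob (A \<inter> (T j -` C \<inter> space M)))
        \<longlongrightarrow> prob A - prob A * prob C) F"
      by (intro tendsto_diff tendsto_const compl)
    ultimately show ?case
      by (simp add: prob_compl[OF C] right_diff_distrib)
  next
    case (union C)
    have C: "C i \<in> events" for i
      using union(2) by (auto intro: sub)
    have sC: "(\<lambda>i. prob (C i)) sums prob (\<Union>i. C i)"
      using C union(1) by (intro finite_measure_UNION) auto
    have sT: "(\<lambda>i. prob (A \<inter> (T j -` C i \<inter> space M))) sums
        prob (A \<inter> (T j -` (\<Union>i. C i) \<inter> space M))" for j
    proof -
      have "(\<lambda>i. prob (A \<inter> (T j -` C i \<inter> space M))) sums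
          prob (\<Union>i. A \<inter> (T j -` C i \<inter> space M))"
        using union(1) A vim[OF C]
        by (intro finite_measure_UNION) (auto simp: disjoint_family_on_def)
      moreover have "(\<Union>i. A \<inter> (T j -` C i \<inter> space M)) = A \<inter> (T j -` (\<Union>i. C i) \<inter> space M)"
        by auto
      ultimately show ?thesis by simp
    qed
    \<comment> \<open>As \<open>T j\<close> preserves the measure, this bound is uniform in
      \<open>j\<close>, and it is summable in \<open>i\<close> because the \<open>C i\<close> are
      disjoint. It is the dominating series for Tannery's theorem.\<close>
    have "prob (A \<inter> (T j -` C i \<inter> space M)) \<le> prob (C i)" for i j
      using finite_measure_mono[OF Int_lower2 vim[OF C], of A j i] pres[OF C] by simp
    then have "((\<lambda>j. \<Sum>i. prob (A \<inter> (T j -` C i \<inter> space M))) \<longlongrightarrow> (\<Sum>i. prob A * prob (C i))) F"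
      using union(3) sC F
      by (intro tannerys_theorem[where M = "\<lambda>i. prob (C i)", THEN conjunct2, THEN conjunct2]
          always_eventually) (auto dest: sums_summable)
    then show ?case
      by (simp only: sums_unique[OF sT, symmetric] sums_unique[OF sums_mult[OF sC], symmetric])
  qed
qed

lemma (in prob_space) zero_one_law_asymptotically_independent:
  assumes G: "Int_stable G" "G \<subseteq> Pow (space M)" "sets M = sigma_sets (space M) G"
    and F: "F \<noteq> bot"
    and T: "\<And>j. T j \<in> measurable M M" "\<And>j. distr M M (T j) = M"
    and indep: "\<And>A B. A \<in> G \<Longrightarrow> B \<in> G \<Longrightarrow>
      eventually (\<lambda>j. prob (A \<inter> (T j -` B \<inter> space M)) = prob A * prob B) F"
    and E: "E \<in> events" "\<And>j. T j -` E \<inter> space M = E"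
  shows "prob E \<in> {0, 1}"
proof -
  have GM: "G \<subseteq> events" using G(3) by auto
  have "prob (A \<inter> E) = prob A * prob E" if "A \<in> G" for A
  proof -
    have "((\<lambda>j. prob (A \<inter> (T j -` E \<inter> space M))) \<longlongrightarrow> prob A * prob E) F"
      by (rule tendsto_prob_Int_vimage[OF G F T])
        (use that GM E(1) in \<open>auto intro: tendsto_eventually indep\<close>)
    \<comment> \<open>By invariance of \<open>E\<close> the converging family is constant in
      \<open>j\<close>, and a limit along a nontrivial filter is unique.\<close>
    then show ?thesis
      using F by (simp add: E(2) tendsto_const_iff)
  qed
  then have "indep_set G {E}"
    using GM E(1) by (auto simp: indep_sets2_eq)
  then have "indep_set (sigma_sets (space M) G) (sigma_sets (space M) {E})"
    by (rule indep_set_sigma_sets) (use G in \<open>auto simp: Int_stable_def\<close>)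
  \<comment> \<open>\<open>E\<close> lies in both generated \<sigma>-algebras, so it is independent
    of itself.\<close>
  then have "prob (E \<inter> E) = prob E * prob E"
    by (rule indep_setD) (use G(3) E(1) in auto)
  then show ?thesis by simp
qed

lemma prob_PiM_cylinder_Int_reindex:
  assumes D: "prob_space D"
    and \<pi>: "\<pi> \<in> I \<rightarrow> I" "inj_on \<pi> I"
    and K: "finite K" "K \<subseteq> I" "\<And>i. i \<in> K \<Longrightarrow> A i \<in> sets D"
    and L: "finite L" "L \<subseteq> I" "\<And>i. i \<in> L \<Longrightarrow> B i \<in> sets D"
    and disj: "\<pi> ` L \<inter> K = {}"
  defines "N \<equiv> \<lambda>_. D"
  shows "measure (PiM I N) (prod_emb I N K (Pi\<^sub>E K A) \<inter>
      ((\<lambda>a. \<lambda>k\<in>I. a (\<pi> k)) -` prod_emb I N L (Pi\<^sub>E L B) \<inter> space (PiM I N))) =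
    measure (PiM I N) (prod_emb I N K (Pi\<^sub>E K A)) * measure (PiM I N) (prod_emb I N L (Pi\<^sub>E L B))"
    (is "measure _ ?S = _")
proof -
  interpret D: prob_space D by fact
  interpret product_prob_space N I
    unfolding N_def by unfold_locales
  define H where "H i = (if i \<in> K then A i else B (the_inv_into I \<pi> i))" for i
  have inv: "the_inv_into I \<pi> (\<pi> i) = i" if "i \<in> I" for i
    using \<pi>(2) that by (rule the_inv_into_f_f)
  have HL: "H (\<pi> i) = B i" if "i \<in> L" for i
    using that disj L(2) inv by (auto simp: H_def)
  have HK: "H i = A i" if "i \<in> K" for i
    using that by (simp add: H_def)
  have sub: "\<pi> ` L \<subseteq> I" "inj_on \<pi> L"
    using \<pi> L(2) by (auto intro: inj_on_subset)
  have H: "H i \<in> sets (N i)" if "i \<in> K \<union> \<pi> ` L" for i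
    using that HK HL K(3) L(3) by (auto simp: N_def)
  have "?S = prod_emb I N (K \<union> \<pi> ` L) (Pi\<^sub>E (K \<union> \<pi> ` L) H)"
  proof (rule set_eqI)
    fix a
    have "a \<in> ?S \<longleftrightarrow> a \<in> space (PiM I N) \<and> (\<forall>i\<in>K. a i \<in> A i) \<and> (\<forall>i\<in>L. a (\<pi> i) \<in> B i)"
      using K(2) L(2) \<pi>(1) by (auto simp: prod_emb_def space_PiM PiE_iff N_def Pi_iff)
    also have "\<dots> \<longleftrightarrow> a \<in> space (PiM I N) \<and> (\<forall>i\<in>K \<union> \<pi> ` L. a i \<in> H i)"
      using HK HL by (auto simp: ball_Un)
    also have "\<dots> \<longleftrightarrow> a \<in> prod_emb I N (K \<union> \<pi> ` L) (Pi\<^sub>E (K \<union> \<pi> ` L) H)"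
      using K(2) sub(1) by (auto simp: prod_emb_def space_PiM PiE_iff)
    finally show "a \<in> ?S \<longleftrightarrow> a \<in> prod_emb I N (K \<union> \<pi> ` L) (Pi\<^sub>E (K \<union> \<pi> ` L) H)" .
  qed
  then have "measure (PiM I N) ?S =
      measure (PiM I N) (prod_emb I N (K \<union> \<pi> ` L) (Pi\<^sub>E (K \<union> \<pi> ` L) H))"
    by (rule arg_cong)
  also have "\<dots> = (\<Prod>i\<in>K \<union> \<pi> ` L. measure (N i) (H i))"
    using K(1,2) L(1) sub(1) by (intro measure_PiM_emb H) auto
  also have "\<dots> = (\<Prod>i\<in>K. measure (N i) (H i)) * (\<Prod>i\<in>\<pi> ` L. measure (N i) (H i))"
    using K(1) L(1) disj by (intro prod.union_disjoint) auto
  also have "(\<Prod>i\<in>\<pi> ` L. measure (N i) (H i)) = (\<Prod>i\<in>L. measure (N i) (B i))"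
    using sub(2) by (simp add: prod.reindex HL N_def)
  also have "(\<Prod>i\<in>K. measure (N i) (H i)) = (\<Prod>i\<in>K. measure (N i) (A i))"
    by (simp add: HK)
  also have "(\<Prod>i\<in>K. measure (N i) (A i)) = measure (PiM I N) (prod_emb I N K (Pi\<^sub>E K A))"
    by (rule measure_PiM_emb[symmetric]) (use K in \<open>auto simp: N_def\<close>)
  also have "(\<Prod>i\<in>L. measure (N i) (B i)) = measure (PiM I N) (prod_emb I N L (Pi\<^sub>E L B))"
    by (rule measure_PiM_emb[symmetric]) (use L in \<open>auto simp: N_def\<close>)
  finally show ?thesis .
qed

text \<open>The canonical case, in which the coordinates themselves are the i.i.d. family.
  Injectivity of a symmetry makes the induced map on the product measure-preserving, and the
  symmetry condition makes \<open>E\<close> invariant under it.\<close>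

lemma PiM_zero_one_law_positional_symmetry:
  fixes \<Gamma> :: "'i set" and D :: "'m measure"
  assumes D: "prob_space D"
    and E: "E \<in> sets (\<Pi>\<^sub>M k\<in>\<Gamma>. D)"
    and sym: "\<And>J. finite J \<Longrightarrow> J \<subseteq> \<Gamma> \<Longrightarrow>
      \<exists>\<pi>. positional_symmetry \<Gamma> D E \<pi> \<and> inj_on \<pi> \<Gamma> \<and> \<pi> ` J \<inter> J = {}"
  shows "measure (\<Pi>\<^sub>M k\<in>\<Gamma>. D) E \<in> {0, 1}"
proof -
  let ?Q = "\<Pi>\<^sub>M k\<in>\<Gamma>. D"
  interpret Q: prob_space ?Q
    using D by (rule prob_space_PiM)
  \<comment> \<open>A symmetry is chosen for every set \<open>J\<close>, so that \<open>T J\<close>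
    is well behaved for all indices; where \<open>J\<close> is not a finite subset of
    \<open>\<Gamma>\<close>, the one given for \<open>{}\<close> serves.\<close>
  have "\<exists>\<pi>. positional_symmetry \<Gamma> D E \<pi> \<and> inj_on \<pi> \<Gamma> \<and>
      (finite J \<longrightarrow> J \<subseteq> \<Gamma> \<longrightarrow> \<pi> ` J \<inter> J = {})" for J
    using sym[of J] sym[of "{}"] by auto
  then obtain \<pi> where \<pi>: "\<And>J. positional_symmetry \<Gamma> D E (\<pi> J)" "\<And>J. inj_on (\<pi> J) \<Gamma>"
      "\<And>J. finite J \<Longrightarrow> J \<subseteq> \<Gamma> \<Longrightarrow> \<pi> J ` J \<inter> J = {}"
    by metis
  have \<pi>_in: "\<pi> J \<in> \<Gamma> \<rightarrow> \<Gamma>" for J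
    using \<pi>(1) by (simp add: positional_symmetry_def)
  define T where "T J a = (\<lambda>k\<in>\<Gamma>. a (\<pi> J k))" for J and a :: "'i \<Rightarrow> 'm"
  show ?thesis
  proof (rule Q.zero_one_law_asymptotically_independent
      [where G = "prod_algebra \<Gamma> (\<lambda>_. D)" and T = T and F = "finite_subsets_at_top \<Gamma>"])
    show "Int_stable (prod_algebra \<Gamma> (\<lambda>_. D))"
      by (rule Int_stable_prod_algebra)
    show "prod_algebra \<Gamma> (\<lambda>_. D) \<subseteq> Pow (space ?Q)"
      using prod_algebra_sets_into_space by (simp add: space_PiM)
    show "sets ?Q = sigma_sets (space ?Q) (prod_algebra \<Gamma> (\<lambda>_. D))"
      by (simp add: sets_PiM space_PiM)
    show "T J \<in> measurable ?Q ?Q" for J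
      unfolding T_def using \<pi>_in[of J]
      by (intro measurable_restrict measurable_component_singleton) auto
    show "distr ?Q ?Q (T J) = ?Q" for J
      unfolding T_def using distr_PiM_reindex[of \<Gamma> "\<lambda>_. D", OF D \<pi>(2) \<pi>_in] by simp
    show "E \<in> sets ?Q" by fact
    show "T J -` E \<inter> space ?Q = E" for J
      using \<pi>(1)[of J] sets.sets_into_space[OF E]
      by (auto simp: positional_symmetry_def T_def space_PiM)
    fix A B
    assume "A \<in> prod_algebra \<Gamma> (\<lambda>_. D)"
    then obtain K F where A: "A = prod_emb \<Gamma> (\<lambda>_. D) K (Pi\<^sub>E K F)" "finite K" "K \<subseteq> \<Gamma>"
        "\<And>i. i \<in> K \<Longrightarrow> F i \<in> sets D"
      by (rule prod_algebraE) blast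
    assume "B \<in> prod_algebra \<Gamma> (\<lambda>_. D)"
    then obtain L G where B: "B = prod_emb \<Gamma> (\<lambda>_. D) L (Pi\<^sub>E L G)" "finite L" "L \<subseteq> \<Gamma>"
        "\<And>i. i \<in> L \<Longrightarrow> G i \<in> sets D"
      by (rule prod_algebraE) blast
    \<comment> \<open>Once \<open>J\<close> contains both supports, \<open>\<pi> J\<close> moves
      \<open>L\<close> off \<open>J\<close> and hence off \<open>K\<close>.\<close>
    have "Q.prob (A \<inter> (T J -` B \<inter> space ?Q)) = Q.prob A * Q.prob B"
      if J: "finite J" "K \<union> L \<subseteq> J" "J \<subseteq> \<Gamma>" for J
    proof -
      have "\<pi> J ` L \<inter> K = {}"
        using \<pi>(3)[OF J(1,3)] J(2) by blast
      then show ?thesis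
        unfolding A(1) B(1) T_def
        using D \<pi>_in \<pi>(2) A B by (intro prob_PiM_cylinder_Int_reindex) auto
    qed
    then show "eventually (\<lambda>J. Q.prob (A \<inter> (T J -` B \<inter> space ?Q)) = Q.prob A * Q.prob B)
        (finite_subsets_at_top \<Gamma>)"
      unfolding eventually_finite_subsets_at_top using A(2,3) B(2,3)
      by (intro exI[of _ "K \<union> L"]) auto
  qed simp
qed

text \<open>Only the joint law of the family matters, and by independence and equality of the
  marginals it is a power of a single law \<open>D\<close>; the canonical case then applies.\<close>

theorem theorem1:
  fixes \<Gamma> :: "'i set" and M :: "'m measure" and P :: "'w measure"
    and X :: "'i \<Rightarrow> 'w \<Rightarrow> 'm" and E :: "('i \<Rightarrow> 'm) set"
  assumes "countable \<Gamma>"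
    and "prob_space P"
    and "prob_space.indep_vars P (\<lambda>_. M) X \<Gamma>"
    and "\<And>i j. i \<in> \<Gamma> \<Longrightarrow> j \<in> \<Gamma> \<Longrightarrow> distr P M (X i) = distr P M (X j)"
    and "E \<in> sets (\<Pi>\<^sub>M k\<in>\<Gamma>. M)"
    and "\<And>J. finite J \<Longrightarrow> J \<subseteq> \<Gamma> \<Longrightarrow>
           \<exists>\<pi>. positional_symmetry \<Gamma> M E \<pi> \<and> inj_on \<pi> \<Gamma> \<and> \<pi> ` J \<inter> J = {}"
  shows "measure P {w \<in> space P. (\<lambda>k\<in>\<Gamma>. X k w) \<in> E} \<in> {0, 1}"
proof (cases "\<Gamma> = {}")
  interpret P: prob_space P by fact
  \<comment> \<open>With no index there is no marginal to serve as \<open>D\<close>; the family is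
    the single point \<open>\<lambda>_. undefined\<close>, so the event is certain or
    impossible.\<close>
  case True
  show ?thesis
    by (cases "(\<lambda>_. undefined) \<in> E") (simp_all add: True restrict_def P.prob_space)
next
  interpret P: prob_space P by fact
  case False
  then obtain i where i: "i \<in> \<Gamma>" by auto
  have X: "X k \<in> measurable P M" if "k \<in> \<Gamma>" for k
    using assms(3) that unfolding P.indep_vars_def by auto
  have X\<Gamma>: "(\<lambda>w. \<lambda>k\<in>\<Gamma>. X k w) \<in> measurable P (\<Pi>\<^sub>M k\<in>\<Gamma>. M)"
    by (intro measurable_restrict X)
  define D where "D = distr P M (X i)"
  have D: "prob_space D"
    unfolding D_def using X[OF i] by (rule P.prob_space_distr)
  have [simp]: "space D = space M" "sets D = sets M"
    by (simp_all add: D_def)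
  have sets_eq: "sets (\<Pi>\<^sub>M k\<in>\<Gamma>. D) = sets (\<Pi>\<^sub>M k\<in>\<Gamma>. M)"
    by (intro sets_PiM_cong) auto
  have "distr P (\<Pi>\<^sub>M k\<in>\<Gamma>. M) (\<lambda>w. \<lambda>k\<in>\<Gamma>. X k w) = (\<Pi>\<^sub>M k\<in>\<Gamma>. distr P M (X k))"
    using P.indep_vars_iff_distr_eq_PiM'[where M' = "\<lambda>_. M", OF False X] assms(3) by simp
  also have "\<dots> = (\<Pi>\<^sub>M k\<in>\<Gamma>. D)"
    unfolding D_def using i by (intro PiM_cong assms(4)) auto
  finally have "measure (\<Pi>\<^sub>M k\<in>\<Gamma>. D) E =
      measure P ((\<lambda>w. \<lambda>k\<in>\<Gamma>. X k w) -` E \<inter> space P)"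
    using measure_distr[OF X\<Gamma> assms(5)] by simp
  also have "(\<lambda>w. \<lambda>k\<in>\<Gamma>. X k w) -` E \<inter> space P = {w \<in> space P. (\<lambda>k\<in>\<Gamma>. X k w) \<in> E}"
    by auto
  finally have "measure P {w \<in> space P. (\<lambda>k\<in>\<Gamma>. X k w) \<in> E} = measure (\<Pi>\<^sub>M k\<in>\<Gamma>. D) E" ..
  \<comment> \<open>The notion depends on the measure only through its space, which \<open>D\<close>
    shares with \<open>M\<close>.\<close>
  moreover have "positional_symmetry \<Gamma> D E = positional_symmetry \<Gamma> M E"
    by (simp add: positional_symmetry_def fun_eq_iff)
  then have "measure (\<Pi>\<^sub>M k\<in>\<Gamma>. D) E \<in> {0, 1}"
    using D assms(5,6) unfolding sets_eq[symmetric]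
    by (intro PiM_zero_one_law_positional_symmetry) metis+
  ultimately show ?thesis by metis
qed

end
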